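(* Let $n\ge 2$ and let $X\subset \Omega_n$ be a subshift. The following conditions are equivalent: (1) For every $\alpha\in\Lambda_n\setminus\{0\}$ the cylinder $[\alpha]_X$ is universally null, that is, $\mu([\alpha]_X)=0$ for every shift invariant measure $\mu$ on $X$. (2) For every $\alpha\in\Lambda_n\setminus\{0\}$ and every $\omega\in X$ we have $d(\{j\in\mathbb{N}:\omega_j=\alpha\})=0$. (3) The atomic measure concentrated on $0^\infty$ is the unique invariant measure for $X$. If any of these conditions holds, then $(\star)$ $h(X)=0$, and $(\star\star)$ $X$ is proximal. Moreover, if $X$ is hereditary, then conditions (1), (2), (3) and $(\star)$ are all equivalent.
   Context: $\mathbb{N}=\{1,2,\ldots\}$. For $n\ge 2$, $\Lambda_n=\{0,1,\ldots,n-1\}$ has the discrete topology and $\Omega_n=\Lambda_n^{\mathbb{N}}$ the product topology; $\sigma\colon\Omega_n\to\Omega_n$, $(\sigma(\omega))_i=\omega_{i+1}$, is the shift. A subshift is a nonempty closed set $X\subset\Omega_n$ with $\sigma(X)\subset X$. A subshift $X\subset\Omega_n$ is hereditary if whenever $\omega\in X$, $\omega'\in\Omega_n$ and $\omega'_i\le\omega_i$ for all $i\in\mathbb{N}$, then $\omega'\in X$. $0^\infty$ is the constant sequence of $0$'s. $[\alpha]_X=\{\omega\in X:\omega_1=\alpha\}$. Invariant measures are $\sigma$-invariant Borel probability measures on $X$. $\mathcal{L}_k(X)$ is the set of words of length $k$ appearing (as blocks of consecutive symbols) in some element of $X$, and the topological entropy is $h(X)=\lim_{k\to\infty}\frac{1}{k}\log\#\mathcal{L}_k(X)$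 (logarithm base 2). For $A\subset\mathbb{N}$, the asymptotic density is $d(A)=\lim_{n\to\infty}\frac{\#(A\cap\{1,\ldots,n\})}{n}$ when this limit exists; "$d(A)=0$" means the limit exists and equals $0$. $X$ is proximal if $\liminf_{k\to\infty}\rho(\sigma^k(x),\sigma^k(y))=0$ for all $x,y\in X$, where $\rho$ is any metric compatible with the topology of $\Omega_n$. *)

theory Defs
  imports "HOL-Probability.Probability"
begin

text \<open>
  One-sided sequences are functions \<open>nat \<Rightarrow> nat\<close>, where the value at \<open>i\<close> is the
  \<open>(i + 1)\<close>-th symbol: the positions \<open>1, 2, \<dots>\<close> of the mathematical text are stored at \<open>0, 1, \<dots>\<close>.
\<close>

definition symbols :: "nat \<Rightarrow> nat set" where
  "symbols n = {0..<n}"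

definition full_shift :: "nat \<Rightarrow> (nat \<Rightarrow> nat) set" where
  "full_shift n = {\<omega>. \<forall>i. \<omega> i \<in> symbols n}"

text \<open>
  The topology on \<^term>\<open>full_shift n\<close> is the one induced by the type class topology on
  \<open>nat \<Rightarrow> nat\<close>; it is the product of the discrete topologies.
\<close>

lemma top_of_set_full_shift:
  "top_of_set (full_shift n) = product_topology (\<lambda>_. discrete_topology (symbols n)) UNIV"
proof -
  have "euclidean = discrete_topology (UNIV :: nat set)"
    by (simp add: topology_eq Topological_Spaces.open_discrete)
  then have disc: "top_of_set (symbols n) = discrete_topology (symbols n)"
    by simp
  have "full_shift n = Pi\<^sub>E UNIV (\<lambda>_. symbols n)"
    by (auto simp: full_shift_def PiE_def)
  then show ?thesis
    by (simp only: subtopology_product_topology disc flip: euclidean_product_topology)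
qed

definition seq_shift :: "(nat \<Rightarrow> nat) \<Rightarrow> (nat \<Rightarrow> nat)" where
  "seq_shift \<omega> = (\<lambda>i. \<omega> (Suc i))"

definition subshift :: "nat \<Rightarrow> (nat \<Rightarrow> nat) set \<Rightarrow> bool" where
  "subshift n X \<longleftrightarrow>
     X \<noteq> {} \<and> X \<subseteq> full_shift n \<and> closedin (top_of_set (full_shift n)) X \<and> seq_shift ` X \<subseteq> X"

definition hereditary :: "nat \<Rightarrow> (nat \<Rightarrow> nat) set \<Rightarrow> bool" where
  "hereditary n X \<longleftrightarrow>
     (\<forall>\<omega>\<in>X. \<forall>\<omega>'\<in>full_shift n. (\<forall>i. \<omega>' i \<le> \<omega> i) \<longrightarrow> \<omega>' \<in> X)"

definition cylinder :: "(nat \<Rightarrow> nat) set \<Rightarrow> nat \<Rightarrow> (nat \<Rightarrow> nat) set" where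
  "cylinder X \<alpha> = {\<omega> \<in> X. \<omega> 0 = \<alpha>}"

abbreviation borel_on :: "(nat \<Rightarrow> nat) set \<Rightarrow> (nat \<Rightarrow> nat) measure" where
  "borel_on X \<equiv> restrict_space borel X"

definition invariant_measure :: "(nat \<Rightarrow> nat) set \<Rightarrow> (nat \<Rightarrow> nat) measure \<Rightarrow> bool" where
  "invariant_measure X \<mu> \<longleftrightarrow>
     prob_space \<mu> \<and> sets \<mu> = sets (borel_on X) \<and>
     (\<forall>A\<in>sets \<mu>. emeasure \<mu> (seq_shift -` A \<inter> X) = emeasure \<mu> A)"

definition universally_null :: "(nat \<Rightarrow> nat) set \<Rightarrow> (nat \<Rightarrow> nat) set \<Rightarrow> bool" where
  "universally_null X A \<longleftrightarrow> (\<forall>\<mu>. invariant_measure X \<mu> \<longrightarrow> emeasure \<mu> A = 0)"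

definition words :: "nat \<Rightarrow> (nat \<Rightarrow> nat) set \<Rightarrow> nat list set" where
  "words k X = {map \<omega> [i..<i + k] | \<omega> i. \<omega> \<in> X}"

text \<open>
  For a subshift the limit exists by subadditivity; at \<open>k = 0\<close> the quotient is the irrelevant
  value \<open>0\<close>.
\<close>

definition entropy :: "(nat \<Rightarrow> nat) set \<Rightarrow> real" where
  "entropy X = lim (\<lambda>k. 1 / real k * log 2 (real (card (words k X))))"

definition has_density :: "nat set \<Rightarrow> real \<Rightarrow> bool" where
  "has_density A d \<longleftrightarrow> (\<lambda>m. real (card (A \<inter> {1..m})) / real m) \<longlonglongrightarrow> d"

text \<open>The occurrences of a symbol, as a set of positions counted from \<open>1\<close>.\<close>

definition occurrences :: "nat \<Rightarrow> (nat \<Rightarrow> nat) \<Rightarrow> nat set" where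
  "occurrences \<alpha> \<omega> = Suc ` {i. \<omega> i = \<alpha>}"

text \<open>
  Proximality does not depend on the choice of a compatible metric; it is required here for all
  of them, and there is at least one, as a countable product of discrete spaces is metrizable.
\<close>

definition compatible_metric :: "nat \<Rightarrow> ((nat \<Rightarrow> nat) \<Rightarrow> (nat \<Rightarrow> nat) \<Rightarrow> real) \<Rightarrow> bool" where
  "compatible_metric n \<rho> \<longleftrightarrow>
     Metric_space (full_shift n) \<rho> \<and>
     Metric_space.mtopology (full_shift n) \<rho> = top_of_set (full_shift n)"

lemma compatible_metric_exists: "\<exists>\<rho>. compatible_metric n \<rho>"
proof -
  have "metrizable_space (top_of_set (full_shift n))"
    by (simp add: top_of_set_full_shift metrizable_space_product_topology
        metrizable_space_discrete_topology)
  then obtain M \<rho> where M: "Metric_space M \<rho>"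
    and top: "top_of_set (full_shift n) = Metric_space.mtopology M \<rho>"
    unfolding metrizable_space_def by blast
  have "M = full_shift n"
    using Metric_space.topspace_mtopology[OF M] top by (metis topspace_euclidean_subtopology)
  with M top show ?thesis
    by (auto simp: compatible_metric_def)
qed

definition proximal :: "nat \<Rightarrow> (nat \<Rightarrow> nat) set \<Rightarrow> bool" where
  "proximal n X \<longleftrightarrow>
     (\<forall>\<rho>. compatible_metric n \<rho> \<longrightarrow>
       (\<forall>x\<in>X. \<forall>y\<in>X.
         liminf (\<lambda>k. ereal (\<rho> ((seq_shift ^^ k) x) ((seq_shift ^^ k) y))) = 0))"

end

theory Submission
  imports Defs
begin

text \<open>
  Let \<open>nonzeros \<omega> k\<close> be the number of nonzero symbols among the first \<open>k\<close> symbols of \<open>\<omega>\<close>. Condition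
  (2) says that \<open>nonzeros \<omega> k / k\<close> tends to \<open>0\<close> for each \<open>\<omega> \<in> X\<close>; under (1) the convergence is even
  uniform on \<open>X\<close>: otherwise the empirical measures of points \<open>x k\<close> with \<open>nonzeros (x k) k \<ge> c * k\<close>
  accumulate at an invariant measure which gives mass at least \<open>c\<close> to the nonzero symbols
  (Krylov--Bogoliubov). Conversely, the integral of \<open>nonzeros \<omega> k / k\<close> with respect to an invariant
  measure does not depend on \<open>k\<close>, so that (2) implies (1) by dominated convergence. By invariance,
  a measure with null nonzero cylinders is concentrated on the zero sequence.

  Uniform sparseness makes the number of words subexponential. Two sequences with few nonzero symbols
  vanish simultaneously on arbitrarily long windows, which gives proximality and the zero sequence as a
  point of \<open>X\<close>. If \<open>X\<close> is hereditary, replacing the nonzero symbols of \<open>\<omega>\<close> by arbitrary symbols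
  \<open>0\<close> or \<open>1\<close> yields \<open>2 ^ nonzeros \<omega> k\<close> words of length \<open>k\<close>.
\<close>

section \<open>Invariant means\<close>

text \<open>By compactness, \<open>f\<close> has a cluster point along \<open>F\<close>. Expressing
  this through closed sets lets a single point inherit every closed condition that holds eventually,
  which is how properties pass to the limit.\<close>

lemma compact_accumulation:
  fixes f :: "'i \<Rightarrow> 'a::topological_space"
  assumes "compact K" "F \<noteq> bot" "eventually (\<lambda>i. f i \<in> K) F"
  shows "\<exists>x. \<forall>S. closed S \<longrightarrow> eventually (\<lambda>i. f i \<in> S) F \<longrightarrow> x \<in> S"
proof -
  have "filtermap f F \<noteq> bot" "eventually (\<lambda>y. y \<in> K) (filtermap f F)"
    using assms by (auto simp: filtermap_bot_iff eventually_filtermap)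
  then obtain x where x: "inf (nhds x) (filtermap f F) \<noteq> bot"
    using \<open>compact K\<close> unfolding compact_filter by blast
  have "x \<in> S" if "closed S" "eventually (\<lambda>i. f i \<in> S) F" for S
  proof (rule ccontr)
    assume "x \<notin> S"
    then have "eventually (\<lambda>y. y \<in> - S) (nhds x)"
      using that by (auto simp: eventually_nhds)
    moreover have "eventually (\<lambda>y. y \<in> S) (filtermap f F)"
      using that by (simp add: eventually_filtermap)
    ultimately have "eventually (\<lambda>_. False) (inf (nhds x) (filtermap f F))"
      unfolding eventually_inf by blast
    with x show False by (simp add: trivial_limit_def)
  qed
  then show ?thesis by blast
qed

text \<open>Tychonoff's theorem, transferred from the abstract product topology to the type class
  topology on functions.\<close>

lemma compact_PiE_UNIV:
  fixes S :: "'i \<Rightarrow> 'a::topological_space set"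
  assumes "\<And>i. compact (S i)"
  shows "compact {f. \<forall>i. f i \<in> S i}"
proof -
  have "{f. \<forall>i. f i \<in> S i} = Pi\<^sub>E UNIV S" by auto
  moreover have "compactin (product_topology (\<lambda>_. euclidean) UNIV) (Pi\<^sub>E UNIV S)"
    using assms by (simp add: compactin_PiE)
  ultimately show ?thesis by (simp add: euclidean_product_topology)
qed

text \<open>This is \<open>k\<close> times the mass that the empirical measure of the orbit segment
  of length \<open>k\<close> starting at \<open>x\<close> gives to \<open>A\<close>. It makes sense
  for arbitrary sets, so no measurability enters at this stage.\<close>

definition orbit_count :: "('a \<Rightarrow> 'a) \<Rightarrow> 'a \<Rightarrow> nat \<Rightarrow> 'a set \<Rightarrow> nat" where
  "orbit_count T x k A = card {i. i < k \<and> (T ^^ i) x \<in> A}"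

lemma orbit_count_Un:
  assumes "A \<inter> B = {}"
  shows "orbit_count T x k (A \<union> B) = orbit_count T x k A + orbit_count T x k B"
proof -
  have "{i. i < k \<and> (T ^^ i) x \<in> A \<union> B} =
      {i. i < k \<and> (T ^^ i) x \<in> A} \<union> {i. i < k \<and> (T ^^ i) x \<in> B}" by auto
  moreover have "{i. i < k \<and> (T ^^ i) x \<in> A} \<inter> {i. i < k \<and> (T ^^ i) x \<in> B} = {}"
    using assms by auto
  ultimately show ?thesis by (simp add: orbit_count_def card_Un_disjoint)
qed

lemma orbit_count_le: "orbit_count T x k A \<le> k"
  unfolding orbit_count_def by (rule order_trans[OF card_mono[of "{..<k}"]]) auto

lemma orbit_count_Suc:
  "orbit_count T x (Suc k) A = orbit_count T x k A + (if (T ^^ k) x \<in> A then 1 else 0)"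
proof -
  have "{i. i < Suc k \<and> (T ^^ i) x \<in> A} =
     (if (T ^^ k) x \<in> A then insert k {i. i < k \<and> (T ^^ i) x \<in> A} else {i. i < k \<and> (T ^^ i) x \<in> A})"
    by (auto simp: less_Suc_eq)
  then show ?thesis by (simp add: orbit_count_def)
qed

text \<open>A visit to the preimage of \<open>A\<close> at time \<open>i\<close> is a visit to
  \<open>A\<close> at time \<open>i + 1\<close>. The difference telescopes and only the
  contributions of the times \<open>k\<close> and \<open>0\<close> survive.\<close>

lemma orbit_count_vimage:
  "\<bar>real (orbit_count T x k (T -` A)) - real (orbit_count T x k A)\<bar> \<le> 1"
proof -
  have "real (orbit_count T x k (T -` A)) - real (orbit_count T x k A) =
      (if (T ^^ k) x \<in> A then 1 else 0) - (if x \<in> A then 1 else 0)"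
    by (induction k) (auto simp: orbit_count_Suc orbit_count_def[of _ _ 0])
  then show ?thesis by auto
qed

text \<open>A cluster point of the empirical frequencies, taken in the compact product space of all set
  functions with values in the unit interval, is a finitely additive invariant mean on all subsets.\<close>

lemma invariant_mean_exists:
  fixes T :: "'a \<Rightarrow> 'a" and x :: "nat \<Rightarrow> 'a"
  assumes freq: "\<exists>\<^sub>F k in sequentially. c * real k \<le> real (orbit_count T (x k) k B)"
  obtains m :: "'a set \<Rightarrow> real" where
    "\<And>A. 0 \<le> m A" "\<And>A A'. A \<inter> A' = {} \<Longrightarrow> m (A \<union> A') = m A + m A'"
    "\<And>A. m (T -` A) = m A" "c \<le> m B" "\<And>A. (\<And>k i. (T ^^ i) (x k) \<in> A) \<Longrightarrow> m A = 1"
proof -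
  define G where "G = {k. c * real k \<le> real (orbit_count T (x k) k B)}"
  \<comment> \<open>Since \<open>G\<close> is hit infinitely often, restricting
    \<open>sequentially\<close> to \<open>G\<close> leaves a proper filter, along which the
    frequency bound holds eventually.\<close>
  define F where "F = inf sequentially (principal G)"
  define avg where "avg k A = real (orbit_count T (x k) k A) / real k" for k A
  have "F \<noteq> bot"
    using freq by (simp add: F_def G_def trivial_limit_def eventually_inf_principal frequently_def)
  have ev: "eventually P F" if "eventually P sequentially" for P
    using that unfolding F_def eventually_inf_principal by (rule eventually_mono) auto
  \<comment> \<open>At \<open>k = 0\<close> the average is \<open>0 / 0 = 0\<close>, so both the
    lower bound \<open>c\<close> and the value \<open>1\<close> are obtained for positive
    \<open>k\<close> only.\<close>
  have pos: "eventually (\<lambda>k. k > 0) F"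
    by (rule ev) (rule eventually_gt_at_top)
  have K: "compact {m :: 'a set \<Rightarrow> real. \<forall>A. m A \<in> {0..1}}"
    by (rule compact_PiE_UNIV) simp
  have "avg k A \<in> {0..1}" for k A
    using orbit_count_le[of T "x k" k A] by (auto simp: avg_def divide_le_eq)
  then have evK: "eventually (\<lambda>k. avg k \<in> {m. \<forall>A. m A \<in> {0..1}}) F" by simp
  obtain m where "\<forall>S. closed S \<longrightarrow> eventually (\<lambda>k. avg k \<in> S) F \<longrightarrow> m \<in> S"
    using compact_accumulation[OF K \<open>F \<noteq> bot\<close> evK] ..
  then have m: "closed S \<Longrightarrow> eventually (\<lambda>k. avg k \<in> S) F \<Longrightarrow> m \<in> S" for S by simp
  \<comment> \<open>Each property wanted of \<open>m\<close> is a closed condition on finitely many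
    coordinates, hence is inherited by the cluster point.\<close>
  note coord = continuous_on_product_coordinates
  have closed_ge: "closed {m :: 'a set \<Rightarrow> real. a \<le> m A}" for a A
    by (intro closed_Collect_le continuous_on_const coord)
  have closed_add: "closed {m :: 'a set \<Rightarrow> real. m (A \<union> A') = m A + m A'}" for A A'
    by (intro closed_Collect_eq continuous_on_add coord)
  have closed_diff: "closed {m :: 'a set \<Rightarrow> real. \<bar>m A - m A'\<bar> \<le> e}" for A A' e
    by (intro closed_Collect_le continuous_on_rabs continuous_on_diff continuous_on_const coord)
  have closed_one: "closed {m :: 'a set \<Rightarrow> real. m A = 1}" for A
    by (intro closed_Collect_eq continuous_on_const coord)
  show ?thesis
  proof (rule that[of m])
    show "0 \<le> m A" for A
      using m[OF closed_ge[of 0 A]] by (simp add: avg_def)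
    show "m (A \<union> A') = m A + m A'" if "A \<inter> A' = {}" for A A'
      using m[OF closed_add[of A A']] by (simp add: avg_def orbit_count_Un[OF that] add_divide_distrib)
    show "m (T -` A) = m A" for A
    proof -
      \<comment> \<open>The averages are invariant only up to \<open>1 / k\<close>. For each fixed
        \<open>e\<close> this is a closed condition that holds eventually, and \<open>e\<close> then
        tends to \<open>0\<close>.\<close>
      have "\<bar>m (T -` A) - m A\<bar> \<le> e" if "e > 0" for e
      proof -
        have "eventually (\<lambda>k. 1 / real k < e) F"
          by (rule ev) (rule order_tendstoD(2)[OF lim_1_over_n \<open>e > 0\<close>])
        then have "eventually (\<lambda>k. \<bar>avg k (T -` A) - avg k A\<bar> \<le> e) F"
        proof (rule eventually_mono)
          fix k assume "1 / real k < e"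
          have "\<bar>avg k (T -` A) - avg k A\<bar> =
              \<bar>real (orbit_count T (x k) k (T -` A)) - real (orbit_count T (x k) k A)\<bar> / real k"
            by (simp add: avg_def diff_divide_distrib[symmetric])
          also have "\<dots> \<le> 1 / real k"
            by (intro divide_right_mono orbit_count_vimage) auto
          finally show "\<bar>avg k (T -` A) - avg k A\<bar> \<le> e" using \<open>1 / real k < e\<close> by simp
        qed
        then show ?thesis using m[OF closed_diff[of "T -` A" A e]] by simp
      qed
      then have "\<bar>m (T -` A) - m A\<bar> \<le> 0" by (rule field_le_epsilon) simp
      then show ?thesis by simp
    qed
    show "c \<le> m B"
    proof -
      have "eventually (\<lambda>k. k \<in> G) F" by (simp add: F_def eventually_inf_principal)
      with pos have "eventually (\<lambda>k. c \<le> avg k B) F"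
        by eventually_elim (simp add: G_def avg_def field_simps)
      then show ?thesis using m[OF closed_ge[of c B]] by simp
    qed
    show "m A = 1" if "\<And>k i. (T ^^ i) (x k) \<in> A" for A
    proof -
      have "eventually (\<lambda>k. avg k A = 1) F"
        using pos by eventually_elim (simp add: avg_def orbit_count_def that)
      then show ?thesis using m[OF closed_one[of A]] by simp
    qed
  qed
qed

section \<open>Existence of invariant measures\<close>

lemma seq_shift_funpow: "(seq_shift ^^ k) \<omega> = (\<lambda>i. \<omega> (i + k))"
  by (induction k arbitrary: \<omega>) (auto simp: seq_shift_def funpow_swap1 simp del: funpow.simps(2) simp: funpow_Suc_right)

lemma subshift_subset: "subshift n X \<Longrightarrow> X \<subseteq> full_shift n"
  by (simp add: subshift_def)

lemma subshift_funpow: "subshift n X \<Longrightarrow> \<omega> \<in> X \<Longrightarrow> (seq_shift ^^ k) \<omega> \<in> X"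
  by (induction k) (auto simp: subshift_def)

lemma compact_full_shift: "compact (full_shift n)"
proof -
  have "compact {\<omega>. \<forall>i :: nat. \<omega> i \<in> symbols n}"
    by (rule compact_PiE_UNIV) (simp add: symbols_def finite_imp_compact)
  then show ?thesis by (simp add: full_shift_def)
qed

lemma coordinate_clopen:
  fixes S :: "nat set"
  shows "open {\<omega> :: nat \<Rightarrow> nat. \<omega> i \<in> S}" "closed {\<omega> :: nat \<Rightarrow> nat. \<omega> i \<in> S}"
proof -
  have "open S" "closed S"
    by (simp_all add: Topological_Spaces.open_discrete closed_def)
  then show "open {\<omega> :: nat \<Rightarrow> nat. \<omega> i \<in> S}" "closed {\<omega> :: nat \<Rightarrow> nat. \<omega> i \<in> S}"
    using open_vimage[of S "\<lambda>\<omega>. \<omega> i"] closed_vimage[of S "\<lambda>\<omega>. \<omega> i"]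
      continuous_on_product_coordinates
    by (simp_all add: vimage_def)
qed

lemma closed_full_shift: "closed (full_shift n)"
proof -
  have "closed (\<Inter>i. {\<omega> :: nat \<Rightarrow> nat. \<omega> i \<in> symbols n})"
    using coordinate_clopen(2) by blast
  moreover have "(\<Inter>i. {\<omega>. \<omega> i \<in> symbols n}) = full_shift n" by (auto simp: full_shift_def)
  ultimately show ?thesis by simp
qed

lemma subshift_closed: "subshift n X \<Longrightarrow> closed X"
  unfolding subshift_def using closed_full_shift closedin_closed_trans by blast

lemma subshift_compact: "subshift n X \<Longrightarrow> compact X"
  using compact_full_shift subshift_closed compact_Int_closed
  by (metis inf.absorb2 subshift_def)

lemma continuous_seq_shift: "continuous_on UNIV seq_shift"
  unfolding seq_shift_def
  by (rule continuous_on_coordinatewise_then_product) (rule continuous_on_product_coordinates)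

section \<open>The algebra of clopen sets and the construction of invariant measures\<close>

definition clopens :: "(nat \<Rightarrow> nat) set \<Rightarrow> (nat \<Rightarrow> nat) set set" where
  "clopens X = {X \<inter> U | U. open U \<and> closed U}"

lemma clopensE:
  assumes "A \<in> clopens X"
  obtains V where "A = X \<inter> V" "open V" "closed V"
  using assms by (auto simp: clopens_def)

lemma algebra_clopens: "algebra X (clopens X)"
proof (unfold algebra_iff_Un, intro conjI ballI)
  show "clopens X \<subseteq> Pow X" by (auto simp: clopens_def)
  show "{} \<in> clopens X" unfolding clopens_def by (auto intro!: exI[of _ "{}"])
next
  fix A assume "A \<in> clopens X"
  then obtain U where "A = X \<inter> U" "open U" "closed U" by (auto simp: clopens_def)
  then have "X - A = X \<inter> (- U)" "open (- U)" "closed (- U)" by auto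
  then show "X - A \<in> clopens X" unfolding clopens_def by blast
next
  fix A B assume "A \<in> clopens X" "B \<in> clopens X"
  then obtain U V where "A = X \<inter> U" "open U" "closed U" "B = X \<inter> V" "open V" "closed V"
    by (auto simp: clopens_def)
  then have "A \<union> B = X \<inter> (U \<union> V)" "open (U \<union> V)" "closed (U \<union> V)" by auto
  then show "A \<union> B \<in> clopens X" unfolding clopens_def by blast
qed

text \<open>Coordinates are measurable for the sigma-algebra generated by the clopen sets, so the
  identity is measurable into the product sigma-algebra. For countably many factors the latter is
  the Borel sigma-algebra.\<close>

lemma sets_borel_on: "sets (borel_on X) = sigma_sets X (clopens X)"
proof
  have "clopens X \<subseteq> sets (borel_on X)"
    by (auto simp: clopens_def sets_restrict_space)
  then have "sigma_sets (space (borel_on X)) (clopens X) \<subseteq> sets (borel_on X)"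
    by (rule sets.sigma_sets_subset)
  then show "sigma_sets X (clopens X) \<subseteq> sets (borel_on X)"
    by (simp add: space_restrict_space)
next
  have C: "clopens X \<subseteq> Pow X" by (auto simp: clopens_def)
  have "(\<lambda>\<omega> i. \<omega> i) \<in> measurable (sigma X (clopens X)) (Pi\<^sub>M UNIV (\<lambda>_. borel :: nat measure))"
  proof (rule measurable_PiM_single')
    fix i :: nat
    show "(\<lambda>\<omega>. \<omega> i) \<in> borel_measurable (sigma X (clopens X))"
    proof (rule measurableI)
      fix S :: "nat set"
      have "(\<lambda>\<omega>. \<omega> i) -` S \<inter> X = X \<inter> {\<omega>. \<omega> i \<in> S}" by auto
      also have "\<dots> \<in> clopens X" unfolding clopens_def using coordinate_clopen by blast
      finally show "(\<lambda>\<omega>. \<omega> i) -` S \<inter> space (sigma X (clopens X)) \<in> sets (sigma X (clopens X))"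
        using C by (simp add: sigma_sets.Basic)
    qed simp
  qed simp
  then have "(\<lambda>\<omega>. \<omega>) \<in> borel_measurable (sigma X (clopens X))"
    by (simp cong: measurable_cong_sets add: sets_PiM_equal_borel)
  from measurable_sets[OF this] C show "sets (borel_on X) \<subseteq> sigma_sets X (clopens X)"
    by (auto simp: sets_restrict_space Int_commute vimage_def)
qed

lemma measurable_seq_shift:
  "subshift n X \<Longrightarrow> seq_shift \<in> measurable (borel_on X) (borel_on X)"
  by (intro measurable_restrict_space3 borel_measurable_continuous_onI continuous_seq_shift)
    (auto simp: subshift_def)

text \<open>On the algebra of clopen sets the mean is a premeasure for free: by compactness, a decreasing
  sequence of clopen sets with empty intersection is eventually empty.\<close>

lemma invariant_measure_exists:
  assumes X: "subshift n X" and x: "\<And>k. x k \<in> X" and U: "open U" "closed U"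
    and freq: "\<exists>\<^sub>F k in sequentially. c * real k \<le> real (orbit_count seq_shift (x k) k U)"
  obtains \<mu> where "invariant_measure X \<mu>" "ennreal c \<le> emeasure \<mu> (X \<inter> U)"
proof -
  obtain m :: "(nat \<Rightarrow> nat) set \<Rightarrow> real" where
    m0: "\<And>A. 0 \<le> m A" and mU: "\<And>A A'. A \<inter> A' = {} \<Longrightarrow> m (A \<union> A') = m A + m A'"
    and mT: "\<And>A. m (seq_shift -` A) = m A" and mc: "c \<le> m U"
    and m1: "\<And>A. (\<And>k i. (seq_shift ^^ i) (x k) \<in> A) \<Longrightarrow> m A = 1"
    using invariant_mean_exists[OF freq] by blast
  \<comment> \<open>All orbit points stay in \<open>X\<close>, so \<open>- X\<close> has mean
    \<open>0\<close>. Hence a set and its trace on \<open>X\<close> have the same mean.\<close>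
  have mX: "m (X \<inter> A) = m A" for A
  proof -
    have "m (- X) = 0"
      using mU[of X "- X"] m1[of X] m1[of UNIV] subshift_funpow[OF X] x by simp
    moreover have "m (- X) = m (A - X) + m (- X - A)"
      using mU[of "A - X" "- X - A"] by (simp add: Un_Diff_cancel2 Diff_eq Int_commute flip: Int_Un_distrib2)
    ultimately have "m (A - X) = 0" using m0[of "A - X"] m0[of "- X - A"] by simp
    moreover have "m A = m (X \<inter> A) + m (A - X)"
    proof -
      have "(X \<inter> A) \<inter> (A - X) = {}" "(X \<inter> A) \<union> (A - X) = A" by auto
      then show ?thesis using mU[of "X \<inter> A" "A - X"] by simp
    qed
    ultimately show ?thesis by simp
  qed
  have m_empty: "m {} = 0" using mU[of "{}" "{}"] by simp
  interpret algebra X "clopens X" by (rule algebra_clopens)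
  have "\<exists>\<nu>. (\<forall>A\<in>clopens X. \<nu> A = ennreal (m A)) \<and> measure_space X (sigma_sets X (clopens X)) \<nu>"
  proof (rule caratheodory_empty_continuous)
    show "positive (clopens X) (\<lambda>A. ennreal (m A))" by (simp add: positive_def m_empty)
    show "additive (clopens X) (\<lambda>A. ennreal (m A))"
      by (simp add: additive_def mU m0)
  next
    fix A assume A: "range A \<subseteq> clopens X" "decseq A" "(\<Inter>i. A i) = {}"
    have cl: "closed (A i)" for i
    proof -
      have "A i \<in> clopens X" using A(1) by blast
      then obtain V where "A i = X \<inter> V" "closed V" by (rule clopensE)
      then show ?thesis using subshift_closed[OF X] by (simp add: closed_Int)
    qed
    have sub: "A i \<subseteq> X" for i
    proof -
      have "A i \<in> clopens X" using A(1) by blast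
      then show ?thesis by (rule clopensE) simp
    qed
    have "\<exists>i. A i = {}"
    proof (rule ccontr)
      assume ne: "\<nexists>i. A i = {}"
      have "X \<inter> (\<Inter>i. A i) \<noteq> {}"
      proof (rule compact_imp_fip[OF subshift_compact[OF X]])
        show "closed T" if "T \<in> range A" for T using that cl by auto
        fix F' assume F': "finite F'" "F' \<subseteq> range A"
        then obtain I where I: "finite I" "F' = A ` I" by (meson finite_subset_image)
        obtain j where j: "\<forall>i\<in>I. i \<le> j"
          using I(1) unfolding finite_nat_set_iff_bounded_le ..
        have "A j \<subseteq> \<Inter>F'" using I j decseqD[OF A(2)] by blast
        then show "X \<inter> \<Inter>F' \<noteq> {}" using ne sub by blast
      qed
      with A(3) show False by simp
    qed
    then obtain i where "A i = {}" ..
    then have "A j = {}" if "i \<le> j" for j using decseqD[OF A(2) that] by simp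
    then have "eventually (\<lambda>j. ennreal (m (A j)) = 0) sequentially"
      by (intro eventually_sequentiallyI[of i]) (simp add: m_empty)
    then show "(\<lambda>j. ennreal (m (A j))) \<longlonglongrightarrow> 0" by (rule tendsto_eventually)
  qed simp
  then obtain \<nu> where \<nu>: "\<And>A. A \<in> clopens X \<Longrightarrow> \<nu> A = ennreal (m A)"
    and ms: "measure_space X (sigma_sets X (clopens X)) \<nu>" by blast
  define \<mu> where "\<mu> = measure_of X (clopens X) \<nu>"
  have C: "clopens X \<subseteq> Pow X" by (rule space_closed)
  have sets: "sets \<mu> = sigma_sets X (clopens X)" and space: "space \<mu> = X"
    using C by (simp_all add: \<mu>_def)
  have emeasure: "emeasure \<mu> A = ennreal (m A)" if "A \<in> clopens X" for A
    using emeasure_measure_of_sigma[of X "sigma_sets X (clopens X)" \<nu> A] ms that \<nu>[OF that]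
    by (simp add: \<mu>_def measure_space_def sigma_sets.Basic emeasure_measure_of[OF _ C] sets_measure_of[OF C])
  have X_clopen: "X \<in> clopens X" by (rule top)
  have "prob_space \<mu>"
    by (rule prob_spaceI) (use emeasure[OF X_clopen] m1[of X] subshift_funpow[OF X] x in \<open>simp add: space\<close>)
  have sets': "sets \<mu> = sets (borel_on X)" by (simp add: sets sets_borel_on)
  have T[measurable]: "seq_shift \<in> measurable \<mu> \<mu>"
    using measurable_seq_shift[OF X] by (simp cong: measurable_cong_sets add: sets')
  \<comment> \<open>Invariance of the mean shows that \<open>\<mu>\<close> and its image under the
    shift agree on clopen sets. These form an intersection-stable generator, so the two measures
    coincide.\<close>
  have "\<mu> = distr \<mu> \<mu> seq_shift"
  proof (rule measure_eqI_generator_eq)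
    show "Int_stable (clopens X)" by (simp add: Int_stable_def Int)
    show "clopens X \<subseteq> Pow X" by (rule C)
    show "sets \<mu> = sigma_sets X (clopens X)" "sets (distr \<mu> \<mu> seq_shift) = sigma_sets X (clopens X)"
      by (simp_all add: sets)
    show "range (\<lambda>_ :: nat. X) \<subseteq> clopens X" "(\<Union>i :: nat. X) = X"
      using X_clopen by simp_all
    show "emeasure \<mu> X \<noteq> \<infinity>" by (simp add: emeasure[OF X_clopen])
    fix A assume A: "A \<in> clopens X"
    then obtain V where V: "A = X \<inter> V" "open V" "closed V" by (rule clopensE)
    have "seq_shift -` A \<inter> X = X \<inter> seq_shift -` V" using X V by (auto simp: subshift_def)
    moreover have "X \<inter> seq_shift -` V \<in> clopens X"
      using V open_vimage[OF _ continuous_seq_shift] closed_vimage[OF _ continuous_seq_shift]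
      unfolding clopens_def by blast
    moreover have "A \<in> sets \<mu>" using A by (simp add: sets sigma_sets.Basic)
    ultimately show "emeasure \<mu> A = emeasure (distr \<mu> \<mu> seq_shift) A"
      using emeasure[OF A] emeasure by (simp add: emeasure_distr space mX mT V)
  qed
  then have "emeasure \<mu> (seq_shift -` A \<inter> X) = emeasure \<mu> A" if "A \<in> sets \<mu>" for A
    using emeasure_distr[OF T that] space by metis
  then have "invariant_measure X \<mu>"
    using \<open>prob_space \<mu>\<close> sets' by (simp add: invariant_measure_def)
  moreover have "X \<inter> U \<in> clopens X" using U unfolding clopens_def by blast
  then have "ennreal c \<le> emeasure \<mu> (X \<inter> U)" using emeasure mc by (simp add: mX ennreal_leI)
  ultimately show ?thesis by (rule that)
qed

section \<open>Sequences with sparse nonzero symbols\<close>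

definition nonzeros :: "(nat \<Rightarrow> nat) \<Rightarrow> nat \<Rightarrow> nat" where
  "nonzeros \<omega> k = card {i. i < k \<and> \<omega> i \<noteq> 0}"

definition zero_density :: "(nat \<Rightarrow> nat) \<Rightarrow> bool" where
  "zero_density \<omega> \<longleftrightarrow> (\<lambda>k. real (nonzeros \<omega> k) / real k) \<longlonglongrightarrow> 0"

lemma nonzeros_orbit_count: "nonzeros \<omega> k = orbit_count seq_shift \<omega> k {\<omega>. \<omega> 0 \<noteq> 0}"
  by (simp add: nonzeros_def orbit_count_def seq_shift_funpow)

lemma nonzeros_le: "nonzeros \<omega> k \<le> k"
  by (simp add: nonzeros_orbit_count orbit_count_le)

text \<open>Translates between positions counted from \<open>1\<close> and indices counted from
  \<open>0\<close>.\<close>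

lemma card_occurrences: "card (occurrences \<alpha> \<omega> \<inter> {1..m}) = card {i. i < m \<and> \<omega> i = \<alpha>}"
proof -
  have "occurrences \<alpha> \<omega> \<inter> {1..m} = Suc ` {i. i < m \<and> \<omega> i = \<alpha>}"
    by (auto simp: occurrences_def)
  then show ?thesis by (simp add: card_image)
qed

text \<open>Each symbol count is at most the count of all nonzero symbols, and that count is a sum
  over the finitely many nonzero symbols of the alphabet.\<close>

lemma zero_density_iff:
  assumes \<omega>: "\<omega> \<in> full_shift n"
  shows "zero_density \<omega> \<longleftrightarrow> (\<forall>\<alpha>\<in>symbols n - {0}. has_density (occurrences \<alpha> \<omega>) 0)"
proof
  assume z: "zero_density \<omega>"
  show "\<forall>\<alpha>\<in>symbols n - {0}. has_density (occurrences \<alpha> \<omega>) 0"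
  proof
    fix \<alpha> assume "\<alpha> \<in> symbols n - {0}"
    then have "card {i. i < m \<and> \<omega> i = \<alpha>} \<le> nonzeros \<omega> m" for m
      unfolding nonzeros_def by (intro card_mono) auto
    then have "real (card {i. i < m \<and> \<omega> i = \<alpha>}) / real m \<le> real (nonzeros \<omega> m) / real m" for m
      by (simp add: divide_right_mono)
    then show "has_density (occurrences \<alpha> \<omega>) 0"
      unfolding has_density_def card_occurrences
      by (intro tendsto_sandwich[OF _ _ tendsto_const z[unfolded zero_density_def]]) simp_all
  qed
next
  assume d: "\<forall>\<alpha>\<in>symbols n - {0}. has_density (occurrences \<alpha> \<omega>) 0"
  have "nonzeros \<omega> m = (\<Sum>\<alpha>\<in>symbols n - {0}. card {i. i < m \<and> \<omega> i = \<alpha>})" for m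
  proof -
    have "{i. i < m \<and> \<omega> i \<noteq> 0} = (\<Union>\<alpha>\<in>symbols n - {0}. {i. i < m \<and> \<omega> i = \<alpha>})"
      using \<omega> by (auto simp: full_shift_def)
    then show ?thesis
      unfolding nonzeros_def by (simp only:) (subst card_UN_disjoint, auto simp: symbols_def)
  qed
  then have "(\<lambda>m. real (nonzeros \<omega> m) / real m) =
      (\<lambda>m. \<Sum>\<alpha>\<in>symbols n - {0}. real (card {i. i < m \<and> \<omega> i = \<alpha>}) / real m)"
    by (simp add: sum_divide_distrib)
  also have "\<dots> \<longlonglongrightarrow> (\<Sum>\<alpha>\<in>symbols n - {0}. 0)"
    using d by (intro tendsto_sum) (simp add: has_density_def card_occurrences del: One_nat_def)
  finally show "zero_density \<omega>" by (simp add: zero_density_def)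
qed

text \<open>If every window of length \<open>m\<close> beyond \<open>N\<close> met a nonzero symbol
  of \<open>x\<close> or \<open>y\<close>, consecutive disjoint windows would force a joint density
  of about \<open>1 / m\<close>, whereas the two densities add up to \<open>0\<close>.\<close>

lemma zero_window:
  assumes "zero_density x" "zero_density y"
  shows "\<exists>k\<ge>N. \<forall>i<m. x (i + k) = 0 \<and> y (i + k) = 0"
proof (rule ccontr)
  assume "\<not> ?thesis"
  then have hit: "\<exists>i<m. x (i + k) \<noteq> 0 \<or> y (i + k) \<noteq> 0" if "k \<ge> N" for k
    using that by blast
  then have "m > 0" by fastforce
  define Z where "Z k = {i. i < k \<and> x i \<noteq> 0} \<union> {i. i < k \<and> y i \<noteq> 0}" for k
  have fin: "finite (Z k)" for k by (simp add: Z_def)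
  have Z_le: "card (Z k) \<le> nonzeros x k + nonzeros y k" for k
    unfolding Z_def nonzeros_def by (rule card_Un_le)
  \<comment> \<open>Every further window of length \<open>m\<close> contributes at least one new
    position.\<close>
  have lower: "j \<le> card (Z (N + j * m))" for j
  proof (induction j)
    case (Suc j)
    obtain i where i: "i < m" "x (i + (N + j * m)) \<noteq> 0 \<or> y (i + (N + j * m)) \<noteq> 0"
      using hit[of "N + j * m"] by auto
    have "insert (i + (N + j * m)) (Z (N + j * m)) \<subseteq> Z (N + Suc j * m)"
      using i by (auto simp: Z_def)
    then have "card (insert (i + (N + j * m)) (Z (N + j * m))) \<le> card (Z (N + Suc j * m))"
      by (intro card_mono fin)
    moreover have "i + (N + j * m) \<notin> Z (N + j * m)" by (simp add: Z_def)
    ultimately show ?case using Suc fin by simp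
  qed simp
  have "(\<lambda>k. real (nonzeros x k) / real k + real (nonzeros y k) / real k) \<longlonglongrightarrow> 0 + 0"
    using assms unfolding zero_density_def by (rule tendsto_add)
  \<comment> \<open>The threshold is half of the rate \<open>1 / m\<close> forced by the windows,
    which leaves room for the offset \<open>N\<close>.\<close>
  then have "eventually (\<lambda>k. real (nonzeros x k) / real k + real (nonzeros y k) / real k < 1 / (2 * real m)) sequentially"
    using \<open>m > 0\<close> by (intro order_tendstoD(2)[where y = 0]) auto
  then obtain K where K: "\<And>k. k \<ge> K \<Longrightarrow>
      real (nonzeros x k) / real k + real (nonzeros y k) / real k < 1 / (2 * real m)"
    by (auto simp: eventually_sequentially)
  \<comment> \<open>The summand \<open>K\<close> brings \<open>k\<close> into the range of the
    density bound. The summand \<open>N\<close> gives \<open>N < j \<le> j * m\<close>, against the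
    inequality \<open>j * m < N\<close> derived below.\<close>
  define j where "j = Suc (K + N)"
  define k where "k = N + j * m"
  have "j \<le> j * m" using \<open>m > 0\<close> by simp
  then have k: "k \<ge> K" "k > 0" by (auto simp: k_def j_def)
  have "real j \<le> real (nonzeros x k) + real (nonzeros y k)"
    using lower[of j] Z_le[of k] by (simp add: k_def)
  also have "\<dots> < real k / (2 * real m)"
    using K[OF k(1)] k(2) \<open>m > 0\<close> by (simp add: field_simps)
  finally have "real j * (2 * real m) < real k" using \<open>m > 0\<close> by (simp add: field_simps)
  then have "real (j * (2 * m)) < real k" by simp
  then have "j * (2 * m) < N + j * m" unfolding k_def by (simp only: of_nat_less_iff)
  then have "j * m < N" by simp
  with \<open>j \<le> j * m\<close> show False by (simp add: j_def)
qed

section \<open>Convergence to the zero sequence and proximality\<close>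

lemma tendsto_zero_sequence:
  fixes z :: "nat \<Rightarrow> nat \<Rightarrow> nat"
  assumes "\<And>m i. i < m \<Longrightarrow> z m i = 0"
  shows "z \<longlonglongrightarrow> (\<lambda>_. 0)"
proof -
  have "(\<lambda>m. z m i) \<longlonglongrightarrow> 0" for i
    by (rule tendsto_eventually, rule eventually_sequentiallyI[of "Suc i"]) (simp add: assms)
  then have "limitin (product_topology (\<lambda>_. euclidean) UNIV) z (\<lambda>_. 0) sequentially"
    by (simp add: limitin_componentwise)
  then show ?thesis by (simp add: euclidean_product_topology)
qed

text \<open>Shifting \<open>\<omega>\<close> to the start of longer and longer blocks of zeros
  yields points of \<open>X\<close> converging to the zero sequence, and \<open>X\<close> is
  closed.\<close>

lemma zero_in_subshift:
  assumes X: "subshift n X" and "\<omega> \<in> X" "zero_density \<omega>"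
  shows "(\<lambda>_. 0) \<in> X"
proof -
  have "\<exists>k. \<forall>i<m. \<omega> (i + k) = 0" for m
    using zero_window[OF assms(3,3), of 0 m] by auto
  then obtain k where k: "\<And>m i. i < m \<Longrightarrow> \<omega> (i + k m) = 0" by metis
  have "(\<lambda>m. (seq_shift ^^ k m) \<omega>) \<longlonglongrightarrow> (\<lambda>_. 0)"
    by (rule tendsto_zero_sequence) (simp add: seq_shift_funpow k)
  then show ?thesis
    by (rule closed_sequentially[OF subshift_closed[OF X] subshift_funpow[OF X \<open>\<omega> \<in> X\<close>]])
qed

text \<open>At the starts of common zero windows both orbits are close to the zero sequence, hence
  to each other. The metric enters only through its topology and the triangle inequality.\<close>

lemma zero_density_proximal:
  assumes X: "subshift n X" and z: "\<And>\<omega>. \<omega> \<in> X \<Longrightarrow> zero_density \<omega>"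
  shows "proximal n X"
  unfolding proximal_def
proof (intro allI impI ballI)
  fix \<rho> x y assume \<rho>: "compatible_metric n \<rho>" and x: "x \<in> X" and y: "y \<in> X"
  interpret Metric_space "full_shift n" \<rho> using \<rho> by (simp add: compatible_metric_def)
  have XF: "X \<subseteq> full_shift n" using X by (simp add: subshift_def)
  have zero: "(\<lambda>_. 0) \<in> full_shift n" using zero_in_subshift[OF X x z[OF x]] XF by blast
  define d where "d k = \<rho> ((seq_shift ^^ k) x) ((seq_shift ^^ k) y)" for k
  have "\<exists>k\<ge>m. \<forall>i<m. x (i + k) = 0 \<and> y (i + k) = 0" for m
    by (rule zero_window[OF z[OF x] z[OF y]])
  then obtain k where k: "\<And>m. k m \<ge> m" "\<And>m i. i < m \<Longrightarrow> x (i + k m) = 0"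
    "\<And>m i. i < m \<Longrightarrow> y (i + k m) = 0" by metis
  have near: "eventually (\<lambda>m. \<rho> ((seq_shift ^^ k m) u) (\<lambda>_. 0) < e) sequentially"
    if "u \<in> X" "\<And>m i. i < m \<Longrightarrow> u (i + k m) = 0" "e > 0" for u e
  proof -
    have "(\<lambda>m. (seq_shift ^^ k m) u) \<longlonglongrightarrow> (\<lambda>_. 0)"
      by (rule tendsto_zero_sequence) (simp add: seq_shift_funpow that)
    then have "limitin (top_of_set (full_shift n)) (\<lambda>m. (seq_shift ^^ k m) u) (\<lambda>_. 0) sequentially"
      using zero XF subshift_funpow[OF X \<open>u \<in> X\<close>]
      by (auto simp: limitin_subtopology intro!: always_eventually)
    then have "limitin mtopology (\<lambda>m. (seq_shift ^^ k m) u) (\<lambda>_. 0) sequentially"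
      using \<rho> by (simp add: compatible_metric_def)
    with \<open>e > 0\<close> show ?thesis
      unfolding limitin_metric by (auto elim: eventually_mono)
  qed
  \<comment> \<open>The bound \<open>k m \<ge> m\<close> makes the times of closeness arbitrarily
    late, as the lower limit requires.\<close>
  have small: "\<exists>l\<ge>N. d l < e" if "e > 0" for N e
  proof -
    have "eventually (\<lambda>m. \<rho> ((seq_shift ^^ k m) x) (\<lambda>_. 0) < e / 2) sequentially"
      "eventually (\<lambda>m. \<rho> ((seq_shift ^^ k m) y) (\<lambda>_. 0) < e / 2) sequentially"
      using near[OF x k(2), of "e / 2"] near[OF y k(3), of "e / 2"] \<open>e > 0\<close> by simp_all
    then have "eventually (\<lambda>m. \<rho> ((seq_shift ^^ k m) x) (\<lambda>_. 0) < e / 2 \<and>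
        \<rho> ((seq_shift ^^ k m) y) (\<lambda>_. 0) < e / 2 \<and> m \<ge> N) sequentially"
      using eventually_ge_at_top[of N] by eventually_elim simp
    then obtain m where m: "\<rho> ((seq_shift ^^ k m) x) (\<lambda>_. 0) < e / 2"
        "\<rho> ((seq_shift ^^ k m) y) (\<lambda>_. 0) < e / 2" "m \<ge> N"
      using eventually_happens'[OF sequentially_bot] by blast
    have "d (k m) \<le> \<rho> ((seq_shift ^^ k m) x) (\<lambda>_. 0) + \<rho> (\<lambda>_. 0) ((seq_shift ^^ k m) y)"
      unfolding d_def
      by (rule triangle) (use zero XF subshift_funpow[OF X x] subshift_funpow[OF X y] in auto)
    also have "\<rho> (\<lambda>_. 0) ((seq_shift ^^ k m) y) = \<rho> ((seq_shift ^^ k m) y) (\<lambda>_. 0)"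
      by (rule commute)
    finally have "d (k m) < e" using m by simp
    moreover have "k m \<ge> N" using k(1)[of m] m(3) by simp
    ultimately show ?thesis by blast
  qed
  have "liminf (\<lambda>l. ereal (d l)) = 0"
  proof (rule antisym)
    show "0 \<le> liminf (\<lambda>l. ereal (d l))"
      by (rule Liminf_bounded) (simp add: d_def)
    show "liminf (\<lambda>l. ereal (d l)) \<le> 0"
    proof (rule ccontr)
      assume "\<not> ?thesis"
      then have "0 < liminf (\<lambda>l. ereal (d l))" by simp
      then obtain e where e: "0 < ereal e" "ereal e < liminf (\<lambda>l. ereal (d l))"
        using ereal_dense2 by blast
      then have "eventually (\<lambda>l. ereal e < ereal (d l)) sequentially"
        using le_Liminf_iff[of "liminf (\<lambda>l. ereal (d l))" sequentially "\<lambda>l. ereal (d l)"] by blast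
      then obtain N where "\<And>l. l \<ge> N \<Longrightarrow> e < d l"
        by (auto simp: eventually_sequentially)
      with small[of e N] e(1) show False by force
    qed
  qed
  then show "liminf (\<lambda>k. ereal (\<rho> ((seq_shift ^^ k) x) ((seq_shift ^^ k) y))) = 0"
    by (simp add: d_def)
qed

section \<open>Null cylinders\<close>

text \<open>One threshold on \<open>k\<close> serves all points of \<open>X\<close>. The entropy
  estimate relies on this, since it counts all words of length \<open>k\<close> at once.\<close>

definition uniformly_sparse :: "(nat \<Rightarrow> nat) set \<Rightarrow> bool" where
  "uniformly_sparse X \<longleftrightarrow>
     (\<forall>c>0. \<forall>\<^sub>F k in sequentially. \<forall>\<omega>\<in>X. real (nonzeros \<omega> k) < c * real k)"

lemma uniformly_sparse_zero_density:
  assumes "uniformly_sparse X" "\<omega> \<in> X"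
  shows "zero_density \<omega>"
  unfolding zero_density_def
proof (rule order_tendstoI)
  fix a :: real assume "a < 0"
  moreover have "0 \<le> real (nonzeros \<omega> k) / real k" for k by simp
  ultimately show "\<forall>\<^sub>F k in sequentially. a < real (nonzeros \<omega> k) / real k"
    by (intro always_eventually allI) (meson order_less_le_trans)
next
  fix a :: real assume "0 < a"
  then have "\<forall>\<^sub>F k in sequentially. \<forall>\<omega>\<in>X. real (nonzeros \<omega> k) < a * real k"
    using assms(1) by (simp add: uniformly_sparse_def)
  then show "\<forall>\<^sub>F k in sequentially. real (nonzeros \<omega> k) / real k < a"
    using eventually_gt_at_top[of 0]
    by eventually_elim (use assms(2) in \<open>simp add: divide_less_eq\<close>)
qed

lemma nonzero_set_UN: "X \<subseteq> full_shift n \<Longrightarrow>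
    X \<inter> {\<omega>. \<omega> 0 \<noteq> 0} = (\<Union>\<alpha>\<in>symbols n - {0}. cylinder X \<alpha>)"
  by (auto simp: cylinder_def full_shift_def subset_iff)

lemma coordinate_in_sets:
  "X \<inter> {\<omega>. \<omega> i \<in> S} \<in> sets (borel_on X)"
  using coordinate_clopen(1)[of i S] by (auto simp: sets_restrict_space)

lemma emeasure_nonzero_iff:
  assumes X: "X \<subseteq> full_shift n" and \<mu>: "sets \<mu> = sets (borel_on X)"
  shows "emeasure \<mu> (X \<inter> {\<omega>. \<omega> 0 \<noteq> 0}) = 0 \<longleftrightarrow> (\<forall>\<alpha>\<in>symbols n - {0}. emeasure \<mu> (cylinder X \<alpha>) = 0)"
proof
  assume 0: "emeasure \<mu> (X \<inter> {\<omega>. \<omega> 0 \<noteq> 0}) = 0"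
  have "X \<inter> {\<omega>. \<omega> 0 \<noteq> 0} \<in> sets \<mu>"
    using coordinate_in_sets[of X 0 "- {0}"] \<mu> by simp
  with 0 show "\<forall>\<alpha>\<in>symbols n - {0}. emeasure \<mu> (cylinder X \<alpha>) = 0"
    by (auto simp: cylinder_def intro: emeasure_eq_0)
next
  assume 0: "\<forall>\<alpha>\<in>symbols n - {0}. emeasure \<mu> (cylinder X \<alpha>) = 0"
  have "cylinder X \<alpha> = X \<inter> {\<omega>. \<omega> 0 \<in> {\<alpha>}}" for \<alpha> by (auto simp: cylinder_def)
  then have "cylinder X \<alpha> \<in> sets \<mu>" for \<alpha>
    using coordinate_in_sets[of X 0 "{\<alpha>}"] \<mu> by simp
  with 0 have "(\<Union>\<alpha>\<in>symbols n - {0}. cylinder X \<alpha>) \<in> null_sets \<mu>"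
    by (intro null_sets_UN') (auto simp: null_sets_def)
  then show "emeasure \<mu> (X \<inter> {\<omega>. \<omega> 0 \<noteq> 0}) = 0"
    unfolding nonzero_set_UN[OF X] by (simp add: null_sets_def)
qed

text \<open>A finite union of null sets is null. Condition (1) thus concerns a single clopen set,
  the one whose visits \<open>nonzeros\<close> counts.\<close>

lemma universally_null_iff:
  assumes "subshift n X"
  shows "(\<forall>\<alpha>\<in>symbols n - {0}. universally_null X (cylinder X \<alpha>)) \<longleftrightarrow>
     universally_null X (X \<inter> {\<omega>. \<omega> 0 \<noteq> 0})"
proof -
  have "emeasure \<mu> (X \<inter> {\<omega>. \<omega> 0 \<noteq> 0}) = 0 \<longleftrightarrow> (\<forall>\<alpha>\<in>symbols n - {0}. emeasure \<mu> (cylinder X \<alpha>) = 0)"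
    if "invariant_measure X \<mu>" for \<mu>
    using that assms by (intro emeasure_nonzero_iff) (auto simp: invariant_measure_def subshift_def)
  then show ?thesis unfolding universally_null_def by blast
qed

text \<open>Failure of uniformity gives infinitely many \<open>k\<close> with a point whose first
  \<open>k\<close> symbols contain at least \<open>c * k\<close> nonzero ones. The limit measure of
  their orbit segments charges the nonzero symbols.\<close>

lemma universally_null_imp_uniformly_sparse:
  assumes X: "subshift n X" and null: "universally_null X (X \<inter> {\<omega>. \<omega> 0 \<noteq> 0})"
  shows "uniformly_sparse X"
proof (rule ccontr)
  assume "\<not> uniformly_sparse X"
  then obtain c where c: "c > 0"
      "\<exists>\<^sub>F k in sequentially. \<exists>\<omega>\<in>X. c * real k \<le> real (nonzeros \<omega> k)"
    by (auto simp: uniformly_sparse_def not_eventually not_less)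
  \<comment> \<open>A point violating sparseness is chosen whenever there is one. For the other
    \<open>k\<close> any point of \<open>X\<close> is taken, so that the whole sequence lies in
    \<open>X\<close>.\<close>
  define x where "x k = (SOME \<omega>. \<omega> \<in> X \<and>
      ((\<exists>\<omega>\<in>X. c * real k \<le> real (nonzeros \<omega> k)) \<longrightarrow> c * real k \<le> real (nonzeros \<omega> k)))" for k
  have "X \<noteq> {}" using X by (simp add: subshift_def)
  then have "\<exists>\<omega>. \<omega> \<in> X \<and>
      ((\<exists>\<omega>\<in>X. c * real k \<le> real (nonzeros \<omega> k)) \<longrightarrow> c * real k \<le> real (nonzeros \<omega> k))" for k by blast
  then have x: "x k \<in> X \<and> ((\<exists>\<omega>\<in>X. c * real k \<le> real (nonzeros \<omega> k)) \<longrightarrow>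
      c * real k \<le> real (nonzeros (x k) k))" for k
    unfolding x_def by (rule someI_ex)
  have "\<exists>\<^sub>F k in sequentially. c * real k \<le> real (orbit_count seq_shift (x k) k {\<omega>. \<omega> 0 \<noteq> 0})"
    unfolding nonzeros_orbit_count[symmetric] using c(2) by (rule frequently_elim1) (use x in blast)
  moreover have "open {\<omega> :: nat \<Rightarrow> nat. \<omega> 0 \<noteq> 0}" "closed {\<omega> :: nat \<Rightarrow> nat. \<omega> 0 \<noteq> 0}"
    using coordinate_clopen[of 0 "- {0}"] by simp_all
  ultimately obtain \<mu> where "invariant_measure X \<mu>" "ennreal c \<le> emeasure \<mu> (X \<inter> {\<omega>. \<omega> 0 \<noteq> 0})"
    using invariant_measure_exists[OF X, of x] x by blast
  with null c(1) show False by (simp add: universally_null_def)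
qed

section \<open>From zero density back to null cylinders\<close>

lemma invariant_measure_coordinate:
  assumes X: "subshift n X" and \<mu>: "invariant_measure X \<mu>"
  shows "emeasure \<mu> (X \<inter> {\<omega>. \<omega> i \<in> S}) = emeasure \<mu> (X \<inter> {\<omega>. \<omega> 0 \<in> S})"
proof (induction i)
  case (Suc i)
  have "seq_shift -` (X \<inter> {\<omega>. \<omega> i \<in> S}) \<inter> X = X \<inter> {\<omega>. \<omega> (Suc i) \<in> S}"
    using X by (auto simp: subshift_def seq_shift_def)
  moreover have "X \<inter> {\<omega>. \<omega> i \<in> S} \<in> sets \<mu>"
    using \<mu> coordinate_in_sets by (simp add: invariant_measure_def)
  then have "emeasure \<mu> (seq_shift -` (X \<inter> {\<omega>. \<omega> i \<in> S}) \<inter> X) = emeasure \<mu> (X \<inter> {\<omega>. \<omega> i \<in> S})"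
    using \<mu> unfolding invariant_measure_def by blast
  ultimately show ?case using Suc by (simp only:)
qed simp

lemma invariant_measure_space: "invariant_measure X \<mu> \<Longrightarrow> space \<mu> = X"
  unfolding invariant_measure_def
  by (metis sets_eq_imp_space_eq space_restrict_space space_borel Int_UNIV_right)

text \<open>The frequency of nonzero symbols has the same expectation for every positive
  \<open>k\<close>, yet tends to \<open>0\<close> pointwise and is bounded by \<open>1\<close>.
  Dominated convergence makes that expectation \<open>0\<close>.\<close>

lemma zero_density_imp_universally_null:
  assumes X: "subshift n X" and z: "\<And>\<omega>. \<omega> \<in> X \<Longrightarrow> zero_density \<omega>"
  shows "universally_null X (X \<inter> {\<omega>. \<omega> 0 \<noteq> 0})"
  unfolding universally_null_def
proof (intro allI impI)
  fix \<mu> assume \<mu>: "invariant_measure X \<mu>"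
  interpret prob_space \<mu> using \<mu> by (simp add: invariant_measure_def)
  have space: "space \<mu> = X" by (rule invariant_measure_space[OF \<mu>])
  define E where "E i = X \<inter> {\<omega>. \<omega> i \<noteq> 0}" for i :: nat
  have E_sets[measurable]: "E i \<in> sets \<mu>" for i
    using \<mu> coordinate_in_sets[of X i "- {0}"] by (simp add: invariant_measure_def E_def)
  have prob_E: "prob (E i) = prob (E 0)" for i
    using invariant_measure_coordinate[OF X \<mu>, of i "- {0}"] by (simp add: measure_def E_def)
  define f where "f k \<omega> = (\<Sum>i<k. indicator (E i) \<omega>) / real k" for k \<omega>
  have f_eq: "f k \<omega> = real (nonzeros \<omega> k) / real k" if "\<omega> \<in> X" for k \<omega>
  proof -
    have "{i. i < k \<and> \<omega> i \<noteq> 0} = {..<k} \<inter> {i. \<omega> \<in> E i}" using that by (auto simp: E_def)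
    then show ?thesis
      by (simp add: f_def nonzeros_def indicator_def sum.If_cases)
  qed
  have f_meas[measurable]: "f k \<in> borel_measurable \<mu>" for k
    unfolding f_def by measurable
  have "(\<lambda>k. expectation (f k)) \<longlonglongrightarrow> expectation (\<lambda>_. 0 :: real)"
  proof (rule integral_dominated_convergence[where w = "\<lambda>_. 1"])
    show "AE \<omega> in \<mu>. (\<lambda>k. f k \<omega>) \<longlonglongrightarrow> 0"
      using z by (intro AE_I2) (simp add: space f_eq zero_density_def)
    show "AE \<omega> in \<mu>. norm (f k \<omega>) \<le> 1" for k
      using nonzeros_le by (intro AE_I2) (simp add: space f_eq divide_le_eq)
  qed simp_all
  \<comment> \<open>By invariance all \<open>E i\<close> have equal mass, so averaging over
    \<open>i\<close> changes nothing. Division by zero makes \<open>f 0\<close> vanish, hence the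
    restriction to positive \<open>k\<close>.\<close>
  moreover have "expectation (f k) = prob (E 0)" if "k > 0" for k
  proof -
    have "expectation (f k) = (\<Sum>i<k. prob (E i)) / real k"
      unfolding f_def by (simp add: integral_sum emeasure_eq_measure)
    also have "(\<Sum>i<k. prob (E i)) = (\<Sum>i<k. prob (E 0))"
      by (rule sum.cong[OF refl prob_E])
    also have "\<dots> / real k = prob (E 0)" using that by simp
    finally show ?thesis .
  qed
  then have "eventually (\<lambda>k. expectation (f k) = prob (E 0)) sequentially"
    using eventually_gt_at_top[of 0] by (rule eventually_mono[rotated])
  then have "(\<lambda>k. expectation (f k)) \<longlonglongrightarrow> prob (E 0)" by (rule tendsto_eventually)
  ultimately have "prob (E 0) = 0" using LIMSEQ_unique by fastforce
  then show "emeasure \<mu> (X \<inter> {\<omega>. \<omega> 0 \<noteq> 0}) = 0" by (simp add: emeasure_eq_measure E_def)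
qed

section \<open>The point mass at the zero sequence\<close>

lemma invariant_measure_zero_return:
  assumes X: "subshift n X" and zero: "(\<lambda>_. 0) \<in> X"
  shows "invariant_measure X (return (borel_on X) (\<lambda>_. 0))"
proof -
  have "seq_shift -` A \<inter> X \<in> sets (borel_on X)" if "A \<in> sets (borel_on X)" for A
    using measurable_sets[OF measurable_seq_shift[OF X] that] by (simp add: space_restrict_space)
  moreover have "prob_space (return (borel_on X) (\<lambda>_. 0))"
    using zero by (intro prob_space_return) (simp add: space_restrict_space)
  ultimately show ?thesis
    using zero by (simp add: invariant_measure_def indicator_def seq_shift_def)
qed

lemma invariant_measure_unique:
  assumes X: "subshift n X" and zero: "(\<lambda>_. 0) \<in> X"
    and null: "universally_null X (X \<inter> {\<omega>. \<omega> 0 \<noteq> 0})" and \<mu>: "invariant_measure X \<mu>"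
  shows "\<mu> = return (borel_on X) (\<lambda>_. 0)"
proof (rule measure_eqI)
  show sets: "sets \<mu> = sets (return (borel_on X) (\<lambda>_. 0))"
    using \<mu> by (simp add: invariant_measure_def)
  interpret prob_space \<mu> using \<mu> by (simp add: invariant_measure_def)
  have space: "space \<mu> = X" by (rule invariant_measure_space[OF \<mu>])
  have "X \<inter> {\<omega>. \<omega> i \<noteq> 0} \<in> null_sets \<mu>" for i
  proof (rule null_setsI)
    show "emeasure \<mu> (X \<inter> {\<omega>. \<omega> i \<noteq> 0}) = 0"
      using invariant_measure_coordinate[OF X \<mu>, of i "- {0}"] null \<mu> by (simp add: universally_null_def)
    show "X \<inter> {\<omega>. \<omega> i \<noteq> 0} \<in> sets \<mu>"
      using \<mu> coordinate_in_sets[of X i "- {0}"] by (simp add: invariant_measure_def)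
  qed
  \<comment> \<open>A sequence other than zero has a nonzero symbol at some index, so countably many
    null sets cover all of them.\<close>
  then have "(\<Union>i. X \<inter> {\<omega>. \<omega> i \<noteq> 0}) \<in> null_sets \<mu>" by (rule null_sets_UN)
  moreover have "(\<Union>i. X \<inter> {\<omega>. \<omega> i \<noteq> 0}) = X - {\<lambda>_. 0}" by auto
  ultimately have null: "X - {\<lambda>_. 0} \<in> null_sets \<mu>" by simp
  then have AE: "AE \<omega> in \<mu>. \<omega> = (\<lambda>_. 0)"
    by (rule AE_I') (auto simp: space)
  fix A assume A: "A \<in> sets \<mu>"
  \<comment> \<open>Almost surely \<open>\<omega>\<close> is the zero sequence, so \<open>A\<close>
    agrees up to a null set with the whole space or with the empty set.\<close>
  have "emeasure \<mu> A = emeasure \<mu> (if (\<lambda>_. 0) \<in> A then space \<mu> else {})"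
    by (rule emeasure_eq_AE) (use AE A zero space in auto)
  also have "\<dots> = indicator A (\<lambda>_. 0)" by (simp add: emeasure_space_1)
  also have "\<dots> = emeasure (return (borel_on X) (\<lambda>_. 0)) A"
    using A sets by simp
  finally show "emeasure \<mu> A = emeasure (return (borel_on X) (\<lambda>_. 0)) A" .
qed

lemma universally_null_iff_unique:
  assumes X: "subshift n X"
  shows "universally_null X (X \<inter> {\<omega>. \<omega> 0 \<noteq> 0}) \<longleftrightarrow>
    {\<mu>. invariant_measure X \<mu>} = {return (borel_on X) (\<lambda>_. 0)}"
proof
  assume null: "universally_null X (X \<inter> {\<omega>. \<omega> 0 \<noteq> 0})"
  obtain \<omega> where "\<omega> \<in> X" using X by (auto simp: subshift_def)
  \<comment> \<open>That the point mass lives on \<open>X\<close> is not assumed; it follows from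
    sparseness of any point of \<open>X\<close>.\<close>
  then have zero: "(\<lambda>_. 0) \<in> X"
    using zero_in_subshift[OF X] universally_null_imp_uniformly_sparse[OF X null]
      uniformly_sparse_zero_density by blast
  show "{\<mu>. invariant_measure X \<mu>} = {return (borel_on X) (\<lambda>_. 0)}"
  proof (intro equalityI subsetI)
    fix \<mu> assume "\<mu> \<in> {\<mu>. invariant_measure X \<mu>}"
    then show "\<mu> \<in> {return (borel_on X) (\<lambda>_. 0)}"
      using invariant_measure_unique[OF X zero null] by (simp only: mem_Collect_eq singleton_iff)
  next
    fix \<mu> assume "\<mu> \<in> {return (borel_on X) (\<lambda>_. 0)}"
    then show "\<mu> \<in> {\<mu>. invariant_measure X \<mu>}"
      using invariant_measure_zero_return[OF X zero] by (simp only: mem_Collect_eq singleton_iff)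
  qed
next
  assume unique: "{\<mu>. invariant_measure X \<mu>} = {return (borel_on X) (\<lambda>_. 0)}"
  have "X \<inter> {\<omega>. \<omega> 0 \<noteq> 0} \<in> sets (borel_on X)"
    using coordinate_in_sets[of X 0 "- {0}"] by simp
  then have null: "emeasure (return (borel_on X) (\<lambda>_. 0)) (X \<inter> {\<omega>. \<omega> 0 \<noteq> 0}) = 0"
    by simp
  show "universally_null X (X \<inter> {\<omega>. \<omega> 0 \<noteq> 0})"
    unfolding universally_null_def
  proof (intro allI impI)
    fix \<mu> assume "invariant_measure X \<mu>"
    then have "\<mu> = return (borel_on X) (\<lambda>_. 0)" using unique by blast
    with null show "emeasure \<mu> (X \<inter> {\<omega>. \<omega> 0 \<noteq> 0}) = 0" by simp
  qed
qed

section \<open>Entropy\<close>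

lemma subadditive_mult_add_le:
  fixes a :: "nat \<Rightarrow> real"
  assumes "\<And>j k. a (j + k) \<le> a j + a k"
  shows "a (q * m + r) \<le> real q * a m + a r"
proof (induction q)
  case (Suc q)
  have "a (Suc q * m + r) \<le> a m + a (q * m + r)"
    using assms[of m "q * m + r"] by (simp add: add.assoc)
  with Suc show ?case by (simp add: algebra_simps)
qed simp

text \<open>The limit is the infimum \<open>L\<close> of the quotients: dividing \<open>k\<close> by
  \<open>m\<close> with remainder compares \<open>a k / k\<close> with \<open>a m / m\<close> for an
  \<open>m\<close> that nearly attains \<open>L\<close>.\<close>

lemma Fekete:
  fixes a :: "nat \<Rightarrow> real"
  assumes sub: "\<And>j k. a (j + k) \<le> a j + a k" and nonneg: "\<And>k. 0 \<le> a k"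
  shows "convergent (\<lambda>k. a k / real k)"
proof -
  define L where "L = (INF k\<in>{1..}. a k / real k)"
  have bdd: "bdd_below ((\<lambda>k. a k / real k) ` {1..})"
    by (rule bdd_belowI[of _ 0]) (auto simp: nonneg)
  have "(\<lambda>k. a k / real k) \<longlonglongrightarrow> L"
  proof (rule order_tendstoI)
    fix x assume "x < L"
    moreover have "L \<le> a k / real k" if "k \<ge> 1" for k
      unfolding L_def using that by (intro cINF_lower bdd) simp
    ultimately show "\<forall>\<^sub>F k in sequentially. x < a k / real k"
      by (intro eventually_sequentiallyI[of 1]) (meson order_less_le_trans)
  next
    fix x assume "L < x"
    then obtain m where m: "m \<ge> 1" "a m / real m < x"
      unfolding L_def using cINF_less_iff[OF _ bdd] by auto
    \<comment> \<open>As all terms are nonnegative, this sum bounds \<open>a (k mod m)\<close> for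
      every \<open>k\<close> simultaneously.\<close>
    define M where "M = (\<Sum>r<m. a r)"
    have "a k / real k \<le> a m / real m + M * (1 / real k)" if "k > 0" for k
    proof -
      have "a k \<le> real (k div m) * a m + a (k mod m)"
        using subadditive_mult_add_le[of a "k div m" m "k mod m"] sub by simp
      also have "a (k mod m) \<le> M"
        unfolding M_def using m nonneg by (intro member_le_sum) auto
      also have "real (k div m) * a m \<le> real k / real m * a m"
        by (intro mult_right_mono nonneg of_nat_div_le_of_nat)
      finally have "a k / real k \<le> (real k / real m * a m + M) / real k"
        by (simp add: divide_right_mono)
      also have "\<dots> = a m / real m + M * (1 / real k)"
        using that m by (simp add: field_simps)
      finally show ?thesis .
    qed
    then have le: "\<forall>\<^sub>F k in sequentially. a k / real k \<le> a m / real m + M * (1 / real k)"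
      using eventually_gt_at_top[of 0] by (rule eventually_mono[rotated])
    have "(\<lambda>k. a m / real m + M * (1 / real k)) \<longlonglongrightarrow> a m / real m + M * 0"
      by (intro tendsto_intros lim_1_over_n)
    then have "\<forall>\<^sub>F k in sequentially. a m / real m + M * (1 / real k) < x"
      using m(2) by (intro order_tendstoD(2)[where y = "a m / real m + M * 0"]) auto
    with le show "\<forall>\<^sub>F k in sequentially. a k / real k < x"
      by eventually_elim simp
  qed
  then show ?thesis by (rule convergentI)
qed

section \<open>Words and existence of the entropy limit\<close>

abbreviation lists_of_length :: "'a set \<Rightarrow> nat \<Rightarrow> 'a list set" where
  "lists_of_length A k \<equiv> {w. set w \<subseteq> A \<and> length w = k}"

lemma words_subset: "X \<subseteq> full_shift n \<Longrightarrow> words k X \<subseteq> lists_of_length (symbols n) k"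
  by (fastforce simp: words_def full_shift_def)

lemma finite_words: "X \<subseteq> full_shift n \<Longrightarrow> finite (words k X)"
  by (rule finite_subset[OF words_subset]) (auto simp: symbols_def intro: finite_lists_length_eq)

text \<open>Shift invariance moves any occurrence of a word to the beginning of a point of
  \<open>X\<close>.\<close>

lemma words_eq_prefixes:
  assumes "subshift n X"
  shows "words k X = (\<lambda>\<omega>. map \<omega> [0..<k]) ` X"
proof
  show "words k X \<subseteq> (\<lambda>\<omega>. map \<omega> [0..<k]) ` X"
  proof
    fix w assume "w \<in> words k X"
    then obtain \<omega> i where w: "w = map \<omega> [i..<i + k]" "\<omega> \<in> X" by (auto simp: words_def)
    have "w = map ((seq_shift ^^ i) \<omega>) [0..<k]"
      by (rule nth_equalityI) (simp_all add: w seq_shift_funpow add.commute)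
    then show "w \<in> (\<lambda>\<omega>. map \<omega> [0..<k]) ` X"
      using subshift_funpow[OF assms w(2)] by blast
  qed
  show "(\<lambda>\<omega>. map \<omega> [0..<k]) ` X \<subseteq> words k X"
    unfolding words_def by (force intro: exI[of _ 0])
qed

lemma card_words_pos:
  assumes "subshift n X"
  shows "1 \<le> card (words k X)"
proof -
  have "words k X \<noteq> {}" using assms unfolding words_eq_prefixes[OF assms] by (simp add: subshift_def)
  moreover have "finite (words k X)" by (rule finite_words[OF subshift_subset[OF assms]])
  ultimately show ?thesis by (simp add: Suc_le_eq card_gt_0_iff)
qed

text \<open>Cutting a word after \<open>j\<close> symbols is injective and both pieces occur in the
  same sequence. Taking logarithms gives the subadditivity required by
  \<open>Fekete\<close>.\<close>

lemma card_words_add_le: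
  assumes "X \<subseteq> full_shift n"
  shows "card (words (j + k) X) \<le> card (words j X) * card (words k X)"
proof -
  have "(\<lambda>w. (take j w, drop j w)) ` words (j + k) X \<subseteq> words j X \<times> words k X"
  proof (rule image_subsetI)
    fix w assume "w \<in> words (j + k) X"
    then obtain \<omega> i where w: "w = map \<omega> [i..<i + (j + k)]" "\<omega> \<in> X" by (auto simp: words_def)
    have "take j w = map \<omega> [i..<i + j]" "drop j w = map \<omega> [i + j..<i + j + k]"
      by (simp_all add: w take_map drop_map add.assoc)
    then show "(take j w, drop j w) \<in> words j X \<times> words k X"
      using w(2) unfolding words_def by blast
  qed
  moreover have "inj_on (\<lambda>w. (take j w, drop j w)) (words (j + k) X)"
    by (rule inj_onI) (metis append_take_drop_id prod.inject)
  ultimately have "card (words (j + k) X) \<le> card (words j X \<times> words k X)"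
    using finite_words[OF assms] by (intro card_inj_on_le) auto
  then show ?thesis by (simp add: card_cartesian_product)
qed

lemma log_card_words_nonneg: "subshift n X \<Longrightarrow> 0 \<le> log 2 (real (card (words k X)))"
  using card_words_pos[of n X k] by simp

text \<open>The definition by \<open>lim\<close> is informative only for a convergent sequence;
  convergence comes from \<open>Fekete\<close>.\<close>

lemma entropy_tendsto:
  assumes X: "subshift n X"
  shows "(\<lambda>k. 1 / real k * log 2 (real (card (words k X)))) \<longlonglongrightarrow> entropy X"
proof -
  define a where "a k = log 2 (real (card (words k X)))" for k
  have pos: "real (card (words k X)) \<ge> 1" for k using card_words_pos[OF X, of k] by simp
  have "a (j + k) \<le> a j + a k" for j k
  proof -
    have "real (card (words (j + k) X)) \<le> real (card (words j X)) * real (card (words k X))"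
      using card_words_add_le[OF subshift_subset[OF X], of j k] by (simp flip: of_nat_mult)
    then have "a (j + k) \<le> log 2 (real (card (words j X)) * real (card (words k X)))"
      unfolding a_def using pos[of "j + k"] by (intro log_mono) auto
    also have "\<dots> = a j + a k"
      unfolding a_def using pos[of j] pos[of k] by (intro log_mult_pos) auto
    finally show ?thesis .
  qed
  then have "convergent (\<lambda>k. a k / real k)"
    by (rule Fekete) (simp add: a_def log_card_words_nonneg[OF X])
  then show ?thesis
    unfolding entropy_def by (simp add: a_def convergent_LIMSEQ_iff)
qed

section \<open>Counting sparse words\<close>

lemma sum_power_nonzeros:
  fixes t :: real
  assumes "n \<ge> 1"
  shows "(\<Sum>w\<in>lists_of_length (symbols n) k. t ^ length (filter (\<lambda>a. a \<noteq> 0) w)) =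
    (1 + (real n - 1) * t) ^ k"
proof (induction k)
  case 0
  have "lists_of_length (symbols n) 0 = {[]}" by auto
  then show ?case by simp
next
  case (Suc k)
  let ?g = "\<lambda>w. t ^ length (filter (\<lambda>a. a \<noteq> 0) w)"
  have fin: "finite (symbols n)" by (simp add: symbols_def)
  have "symbols n = insert 0 {1..<n}" using assms by (auto simp: symbols_def)
  then have one: "(\<Sum>a\<in>symbols n. ?g [a]) = 1 + (real n - 1) * t"
    using assms by simp
  \<comment> \<open>Splitting off the first symbol factors the weight, so each position contributes
    \<open>1\<close> for the symbol \<open>0\<close> and \<open>t\<close> for each of the
    \<open>n - 1\<close> others.\<close>
  have "(\<Sum>w\<in>lists_of_length (symbols n) (Suc k). ?g w) =
      (\<Sum>p\<in>lists_of_length (symbols n) k \<times> symbols n. ?g (snd p # fst p))"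
    unfolding lists_length_Suc_eq
    by (subst sum.reindex) (auto intro!: inj_onI sum.cong simp: case_prod_beta)
  also have "\<dots> = (\<Sum>p\<in>lists_of_length (symbols n) k \<times> symbols n. ?g (fst p) * ?g [snd p])"
    by (intro sum.cong) auto
  also have "\<dots> = (\<Sum>w\<in>lists_of_length (symbols n) k. ?g w) * (\<Sum>a\<in>symbols n. ?g [a])"
    unfolding sum_product sum.cartesian_product by (simp add: case_prod_beta)
  finally show ?case unfolding one Suc by simp
qed

lemma length_filter_nonzeros: "length (filter (\<lambda>a. a \<noteq> 0) (map \<omega> [0..<k])) = nonzeros \<omega> k"
  unfolding nonzeros_def length_filter_conv_card by (intro arg_cong[where f = card]) auto

text \<open>Weighting a word with \<open>j\<close> nonzero symbols by \<open>t ^ j\<close> bounds the number of sparse words,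
  as all the weights sum to \<open>(1 + (n - 1) t) ^ k\<close>.\<close>

lemma log_card_words_le:
  fixes t c :: real
  assumes X: "subshift n X" and "n \<ge> 1" and t: "0 < t" "t \<le> 1"
    and sparse: "\<And>\<omega>. \<omega> \<in> X \<Longrightarrow> real (nonzeros \<omega> k) \<le> c * real k"
  shows "log 2 (real (card (words k X))) \<le> real k * (log 2 (1 + (real n - 1) * t) - c * log 2 t)"
proof -
  let ?g = "\<lambda>w. t ^ length (filter (\<lambda>a. a \<noteq> 0) w)"
  have XF: "X \<subseteq> full_shift n" by (rule subshift_subset[OF X])
  have "real (card (words k X)) * t powr (c * real k) = (\<Sum>w\<in>words k X. t powr (c * real k))"
    by simp
  also have "\<dots> \<le> (\<Sum>w\<in>words k X. ?g w)"
  proof (rule sum_mono)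
    fix w assume "w \<in> words k X"
    then obtain \<omega> where w: "w = map \<omega> [0..<k]" "\<omega> \<in> X"
      unfolding words_eq_prefixes[OF X] by blast
    \<comment> \<open>The exponent \<open>c * real k\<close> need not be an integer, hence
      \<open>powr\<close>. Since \<open>t \<le> 1\<close>, fewer nonzero symbols mean a larger
      weight.\<close>
    have "t powr (c * real k) \<le> t powr real (nonzeros \<omega> k)"
      using sparse[OF w(2)] t by (intro powr_mono') auto
    then show "t powr (c * real k) \<le> ?g w"
      using t unfolding w length_filter_nonzeros by (simp add: powr_realpow)
  qed
  also have "\<dots> \<le> (\<Sum>w\<in>lists_of_length (symbols n) k. ?g w)"
    using t words_subset[OF XF]
    by (intro sum_mono2) (auto simp: symbols_def intro: finite_lists_length_eq)
  also have "\<dots> = (1 + (real n - 1) * t) ^ k"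
    by (rule sum_power_nonzeros) fact
  finally have le: "real (card (words k X)) * t powr (c * real k) \<le> (1 + (real n - 1) * t) ^ k" .
  have pos: "real (card (words k X)) > 0" using card_words_pos[OF X, of k] by simp
  have B: "1 + (real n - 1) * t > 0"
    using \<open>n \<ge> 1\<close> t by (intro add_pos_nonneg) auto
  have "log 2 (real (card (words k X))) + c * real k * log 2 t =
      log 2 (real (card (words k X)) * t powr (c * real k))"
    using pos t by (subst log_mult_pos) (auto simp: log_powr)
  also have "\<dots> \<le> log 2 ((1 + (real n - 1) * t) ^ k)"
    using le pos t by (intro log_mono) auto
  also have "\<dots> = real k * log 2 (1 + (real n - 1) * t)"
    using B by (simp add: log_nat_power)
  finally show ?thesis by (simp add: algebra_simps)
qed

lemma uniformly_sparse_entropy: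
  assumes X: "subshift n X" and n: "n \<ge> 1" and "uniformly_sparse X"
  shows "entropy X = 0"
proof -
  let ?h = "\<lambda>k. 1 / real k * log 2 (real (card (words k X)))"
  have "?h \<longlonglongrightarrow> 0"
  proof (rule order_tendstoI)
    fix x :: real assume "x < 0"
    moreover have "0 \<le> ?h k" for k using log_card_words_nonneg[OF X] by simp
    ultimately show "\<forall>\<^sub>F k in sequentially. x < ?h k"
      by (intro always_eventually allI) (meson order_less_le_trans)
  next
    fix e :: real assume e: "0 < e"
    \<comment> \<open>The second bound makes \<open>log 2 (1 + (real n - 1) * t)\<close> smaller
      than \<open>e / 2\<close>; the first provides \<open>t \<le> 1\<close>.\<close>
    define t where "t = min 1 (e * ln 2 / (2 * real n))"
    have t: "0 < t" "t \<le> 1" using e n by (auto simp: t_def)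
    \<comment> \<open>With this \<open>c\<close> the remaining term \<open>- (c * log 2 t)\<close>
      is also below \<open>e / 2\<close>. The summand \<open>1\<close> keeps the denominator
      positive when \<open>t = 1\<close>.\<close>
    define c where "c = e / 2 / (1 - log 2 t)"
    have log_t: "log 2 t \<le> 0" using t by simp
    have c: "0 < c" "- (c * log 2 t) < e / 2"
      using e log_t by (auto simp: c_def field_simps)
    have "(real n - 1) * t < real n * t"
      using t(1) by (intro mult_strict_right_mono) simp_all
    also have "\<dots> \<le> real n * (e * ln 2 / (2 * real n))"
      by (intro mult_left_mono) (simp_all add: t_def)
    also have "\<dots> = e / 2 * ln 2" using n by simp
    finally have B: "(real n - 1) * t < e / 2 * ln 2" .
    have "ln (1 + (real n - 1) * t) \<le> (real n - 1) * t"
      using t n by (intro ln_add_one_self_le_self) auto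
    with B have "log 2 (1 + (real n - 1) * t) < e / 2"
      by (simp add: log_def divide_less_eq)
    with c have bound: "log 2 (1 + (real n - 1) * t) - c * log 2 t < e" by simp
    have "\<forall>\<^sub>F k in sequentially. \<forall>\<omega>\<in>X. real (nonzeros \<omega> k) < c * real k"
      using \<open>uniformly_sparse X\<close> c(1) by (simp add: uniformly_sparse_def)
    then show "\<forall>\<^sub>F k in sequentially. ?h k < e"
      using eventually_gt_at_top[of 0]
    proof eventually_elim
      case (elim k)
      have "log 2 (real (card (words k X))) \<le> real k * (log 2 (1 + (real n - 1) * t) - c * log 2 t)"
        using elim(1) by (intro log_card_words_le[OF X n t]) (simp add: less_imp_le)
      then have "?h k \<le> log 2 (1 + (real n - 1) * t) - c * log 2 t"
        using elim(2) by (simp add: field_simps)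
      with bound show ?case by simp
    qed
  qed
  with entropy_tendsto[OF X] show ?thesis using LIMSEQ_unique by blast
qed

section \<open>Hereditary subshifts\<close>

lemma hereditary_card_words:
  assumes X: "subshift n X" and n: "n \<ge> 2" and her: "hereditary n X" and \<omega>: "\<omega> \<in> X"
  shows "2 ^ nonzeros \<omega> k \<le> card (words k X)"
proof -
  define N where "N = {i. i < k \<and> \<omega> i \<noteq> 0}"
  define f where "f S = map (\<lambda>i. if i \<in> S then 1 else 0 :: nat) [0..<k]" for S :: "nat set"
  have "f ` Pow N \<subseteq> words k X"
  proof (rule image_subsetI)
    fix S assume "S \<in> Pow N"
    \<comment> \<open>The indicator sequence of a set \<open>S\<close> of nonzero positions lies
      below \<open>\<omega>\<close>, so heredity puts it into \<open>X\<close>. Different subsets of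
      \<open>N\<close> give different prefixes.\<close>
    then have le: "(if i \<in> S then 1 else 0) \<le> \<omega> i" for i by (auto simp: N_def Suc_le_eq)
    have "(\<lambda>i. if i \<in> S then 1 else 0) \<in> full_shift n"
      using n by (simp add: full_shift_def symbols_def)
    then have "(\<lambda>i. if i \<in> S then 1 else 0) \<in> X"
      using her[unfolded hereditary_def, rule_format, OF \<omega>] le by simp
    then show "f S \<in> words k X" unfolding words_eq_prefixes[OF X] f_def by blast
  qed
  moreover have "inj_on f (Pow N)"
  proof (rule inj_onI)
    fix S T assume S: "S \<in> Pow N" "T \<in> Pow N" and eq: "f S = f T"
    have "i \<in> S \<longleftrightarrow> i \<in> T" if "i < k" for i
      using arg_cong[OF eq, of "\<lambda>w. w ! i"] that by (simp add: f_def split: if_splits)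
    with S show "S = T" by (auto simp: N_def)
  qed
  moreover have "finite (words k X)" by (rule finite_words[OF subshift_subset[OF X]])
  ultimately have "card (Pow N) \<le> card (words k X)" by (intro card_inj_on_le)
  then show ?thesis by (simp add: card_Pow N_def nonzeros_def)
qed

text \<open>The base 2 logarithm of the word count is at least \<open>nonzeros \<omega> k\<close>,
  which squeezes the frequency between \<open>0\<close> and the entropy quotient.\<close>

lemma hereditary_entropy_zero_density:
  assumes X: "subshift n X" and n: "n \<ge> 2" and her: "hereditary n X" and 0: "entropy X = 0"
    and \<omega>: "\<omega> \<in> X"
  shows "zero_density \<omega>"
  unfolding zero_density_def
proof (rule tendsto_sandwich[OF _ _ tendsto_const entropy_tendsto[OF X, unfolded 0]])
  show "\<forall>\<^sub>F k in sequentially. 0 \<le> real (nonzeros \<omega> k) / real k" by simp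
  have "real (nonzeros \<omega> k) / real k \<le> 1 / real k * log 2 (real (card (words k X)))" for k
  proof -
    have "2 ^ nonzeros \<omega> k \<le> real (card (words k X))"
      using of_nat_mono[OF hereditary_card_words[OF X n her \<omega>, of k], where 'a = real] by simp
    then have "log 2 (2 ^ nonzeros \<omega> k) \<le> log 2 (real (card (words k X)))"
      by (intro log_mono) auto
    then show ?thesis by (simp add: log_nat_power divide_right_mono)
  qed
  then show "\<forall>\<^sub>F k in sequentially.
      real (nonzeros \<omega> k) / real k \<le> 1 / real k * log 2 (real (card (words k X)))" by simp
qed

theorem theorem14:
  fixes n :: nat and X :: "(nat \<Rightarrow> nat) set"
  assumes "n \<ge> 2" and "subshift n X"
  shows
    "let C1 = (\<forall>\<alpha> \<in> symbols n - {0}. universally_null X (cylinder X \<alpha>));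
         C2 = (\<forall>\<alpha> \<in> symbols n - {0}. \<forall>\<omega> \<in> X. has_density (occurrences \<alpha> \<omega>) 0);
         C3 = ({\<mu>. invariant_measure X \<mu>} = {return (borel_on X) (\<lambda>_. 0)})
     in (C1 \<longleftrightarrow> C2) \<and> (C2 \<longleftrightarrow> C3) \<and>
        (C1 \<or> C2 \<or> C3 \<longrightarrow> entropy X = 0 \<and> proximal n X) \<and>
        (hereditary n X \<longrightarrow>
          (C1 \<longleftrightarrow> entropy X = 0) \<and> (C2 \<longleftrightarrow> entropy X = 0) \<and> (C3 \<longleftrightarrow> entropy X = 0))"
proof -
  note n = \<open>n \<ge> 2\<close> and X = \<open>subshift n X\<close>
  define C1 where "C1 \<longleftrightarrow> (\<forall>\<alpha> \<in> symbols n - {0}. universally_null X (cylinder X \<alpha>))"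
  define C2 where "C2 \<longleftrightarrow> (\<forall>\<alpha> \<in> symbols n - {0}. \<forall>\<omega> \<in> X. has_density (occurrences \<alpha> \<omega>) 0)"
  define C3 where "C3 \<longleftrightarrow> ({\<mu>. invariant_measure X \<mu>} = {return (borel_on X) (\<lambda>_. 0)})"
  have C1: "C1 \<longleftrightarrow> universally_null X (X \<inter> {\<omega>. \<omega> 0 \<noteq> 0})"
    unfolding C1_def by (rule universally_null_iff[OF X])
  have C2: "C2 \<longleftrightarrow> (\<forall>\<omega>\<in>X. zero_density \<omega>)"
  proof -
    have "zero_density \<omega> \<longleftrightarrow> (\<forall>\<alpha>\<in>symbols n - {0}. has_density (occurrences \<alpha> \<omega>) 0)"
      if "\<omega> \<in> X" for \<omega>
      using that subshift_subset[OF X] by (intro zero_density_iff) blast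
    then show ?thesis unfolding C2_def by metis
  qed
  have 13: "C1 \<longleftrightarrow> C3"
    unfolding C1 C3_def by (rule universally_null_iff_unique[OF X])
  \<comment> \<open>Both condition (2) and zero entropy are reached from (1) through the uniform
    estimate.\<close>
  have sparse: "C1 \<Longrightarrow> uniformly_sparse X"
    unfolding C1 by (rule universally_null_imp_uniformly_sparse[OF X])
  have 12: "C1 \<longleftrightarrow> C2"
  proof
    show "C1 \<Longrightarrow> C2"
      unfolding C2 using uniformly_sparse_zero_density[OF sparse] by simp
    show "C2 \<Longrightarrow> C1"
      unfolding C1 C2 using zero_density_imp_universally_null[OF X] by simp
  qed
  have "C1 \<Longrightarrow> entropy X = 0"
    using uniformly_sparse_entropy[OF X _ sparse] n by simp
  moreover have "C2 \<Longrightarrow> proximal n X"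
    unfolding C2 using zero_density_proximal[OF X] by simp
  moreover have "hereditary n X \<Longrightarrow> entropy X = 0 \<Longrightarrow> C2"
    unfolding C2 using hereditary_entropy_zero_density[OF X n] by simp
  ultimately show ?thesis
    unfolding Let_def C1_def[symmetric] C2_def[symmetric] C3_def[symmetric] using 12 13 by blast
qed

end
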